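(* Assume ZFC together with the continuum hypothesis $2^{\aleph_0}=\aleph_1$. Then the generalized Borel conjecture GBC for ${}^{\omega_1}2$ is false; that is, there is a strong measure zero set $A\subseteq{}^{\omega_1}2$ with $|A|>\aleph_1$.
   Context: For an ordinal $\xi$, ${}^{\xi}2$ is the set of functions $\xi\to\{0,1\}$. For $\xi<\omega_1$ and $f\in{}^{\xi}2$ put $[f]=\{\eta\in{}^{\omega_1}2: f\subseteq\eta\}$. A set $A\subseteq{}^{\omega_1}2$ has strong measure zero if for every $X\subseteq\omega_1$ with $|X|=\aleph_1$ there are $f_\xi\in{}^{\xi}2$ ($\xi\in X$) with $A\subseteq\bigcup_{\xi\in X}[f_\xi]$. GBC is the statement that every strong measure zero subset of ${}^{\omega_1}2$ has cardinality at most $\aleph_1$. *)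

theory Defs
  imports Main
begin

unbundle cardinal_syntax

text \<open>The points of \<^typ>\<open>nat suc\<close> are the countable ordinals: \<^term>\<open>card_suc natLeq\<close>
  well-orders the whole type in the initial order type \<open>\<omega>\<^sub>1\<close>, so that it also serves as the
  cardinal \<open>\<aleph>\<^sub>1\<close>.  An ordinal \<open>\<xi>\<close>, regarded as the set of smaller ordinals, is
  \<open>underS omega1 \<xi>\<close>.\<close>

type_synonym omega1 = "nat suc"

abbreviation omega1 :: "omega1 rel" where
  "omega1 \<equiv> card_suc natLeq"

text \<open>The elements of \<open>\<^sup>\<xi>2\<close>; the values \<open>0, 1\<close> are represented by \<^typ>\<open>bool\<close>.\<close>

definition binary_seqs :: "omega1 \<Rightarrow> (omega1 \<rightharpoonup> bool) set" where
  "binary_seqs \<xi> = {f. dom f = underS omega1 \<xi>}"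

definition basic_open :: "(omega1 \<rightharpoonup> bool) \<Rightarrow> (omega1 \<Rightarrow> bool) set" where
  "basic_open f = {\<eta>. f \<subseteq>\<^sub>m (Some \<circ> \<eta>)}"

definition strong_measure_zero :: "(omega1 \<Rightarrow> bool) set \<Rightarrow> bool" where
  "strong_measure_zero A \<longleftrightarrow>
     (\<forall>X :: omega1 set. |X| =o omega1 \<longrightarrow>
        (\<exists>f. (\<forall>\<xi>\<in>X. f \<xi> \<in> binary_seqs \<xi>) \<and> A \<subseteq> (\<Union>\<xi>\<in>X. basic_open (f \<xi>))))"

text \<open>The generalized Borel conjecture for \<open>\<omega>\<^sub>1\<close>.\<close>

definition GBC :: bool where
  "GBC \<longleftrightarrow> (\<forall>A. strong_measure_zero A \<longrightarrow> |A| \<le>o omega1)"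

end

theory Submission
  imports Defs
begin

text \<open>
  Take a set \<open>A\<close> of points with \<open>|A| = \<aleph>\<^sub>2\<close>. Suppose that \<open>A\<close> does not have strong measure zero,
  as witnessed by \<open>X\<close>. Split \<open>X\<close> into \<open>\<omega>\<^sub>1\<close> countable blocks, let \<open>b i\<close> bound the \<open>i\<close>-th block, and let
  \<open>d \<eta> i\<close> code the restriction of \<open>\<eta>\<close> to \<open>b i\<close> as a countable ordinal, which CH allows. For each \<open>h\<close>,
  only countably many codes lie below \<open>h i\<close>, so the countably many levels in the \<open>i\<close>-th block suffice
  to cover every \<open>\<eta>\<close> with \<open>d \<eta> i < h i\<close>. As \<open>X\<close> is a counterexample, some \<open>\<eta> \<in> A\<close> satisfies
  \<open>h \<le> d \<eta>\<close> everywhere.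

  Hence the functions \<open>d \<eta>\<close> form a dominating family of size at most \<open>\<aleph>\<^sub>2\<close>, which makes the \<open>\<omega>\<^sub>1\<close>
  analogue of Luzin's construction work even if there are more than \<open>\<aleph>\<^sub>2\<close> points. Each member \<open>d \<alpha>\<close>
  yields the dense open set of all \<open>\<eta>\<close> that agree, for some \<open>i\<close>, with the \<open>i\<close>-th bounded sequence
  below \<open>d \<alpha> i\<close>. Pick distinct points \<open>f \<gamma>\<close>, \<open>\<gamma> < \<omega>\<^sub>2\<close>, in the first \<open>\<gamma> + 1\<close> of these sets. Given \<open>X\<close>,
  half of it is dominated by some \<open>d \<alpha>\<close> and covers all \<open>f \<gamma>\<close> with \<open>\<gamma> \<ge> \<alpha>\<close>; the other half covers the
  remaining \<open>\<aleph>\<^sub>1\<close> points one by one.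
\<close>

section \<open>Successor cardinals as well-ordered types\<close>

text \<open>The constant \<^const>\<open>card_suc\<close> ignores its argument, so the choice of \<open>|UNIV|\<close> is immaterial.\<close>

instantiation suc :: (type) wellorder
begin

definition less_eq_suc :: "'a suc \<Rightarrow> 'a suc \<Rightarrow> bool" where
  "x \<le> y \<longleftrightarrow> (x, y) \<in> card_suc |UNIV :: 'a set|"

definition less_suc :: "'a suc \<Rightarrow> 'a suc \<Rightarrow> bool" where
  "(x :: 'a suc) < y \<longleftrightarrow> x \<le> y \<and> x \<noteq> y"

instance
proof
  let ?r = "card_suc |UNIV :: 'a set|"
  have "Well_order ?r"
    using Card_order_card_suc[OF card_of_card_order_on] by (blast intro: card_order_on_well_order_on)
  then have r: "refl_on UNIV ?r" "trans ?r" "antisym ?r" "total_on UNIV ?r" "wf (?r - Id)"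
    by (simp_all add: well_order_on_def linear_order_on_def partial_order_on_def preorder_on_def
        Field_card_suc)
  fix x y z :: "'a suc"
  show "x \<le> x" using r(1) by (simp add: less_eq_suc_def refl_on_def)
  show "x \<le> y \<Longrightarrow> y \<le> z \<Longrightarrow> x \<le> z" using r(2) unfolding less_eq_suc_def by (rule transD)
  show "x \<le> y \<Longrightarrow> y \<le> x \<Longrightarrow> x = y" using r(3) unfolding less_eq_suc_def by (rule antisymD)
  show "x \<le> y \<or> y \<le> x"
    using r(1,4) by (cases "x = y") (auto simp: less_eq_suc_def total_on_def refl_on_def)
  show "x < y \<longleftrightarrow> x \<le> y \<and> \<not> y \<le> x"
    using r(1) antisymD[OF r(3)] by (auto simp: less_suc_def less_eq_suc_def refl_on_def)
  fix P :: "'a suc \<Rightarrow> bool" and a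
  assume step: "\<And>x. (\<And>y. y < x \<Longrightarrow> P y) \<Longrightarrow> P x"
  show "P a"
    using r(5)
  proof (induction a rule: wf_induct_rule)
    case (less x)
    show ?case by (rule step, rule less) (simp add: less_suc_def less_eq_suc_def)
  qed
qed

end

lemma underS_card_suc: "underS (card_suc r) x = {..<x}"
  unfolding underS_def less_suc_def less_eq_suc_def lessThan_def card_suc_def by auto

lemma card_of_UNIV_card_suc:
  assumes "card_order (r :: 'a rel)"
  shows "|UNIV :: 'a suc set| =o card_suc r"
  using card_of_Field_ordIso[OF Card_order_card_suc[OF assms]] by (simp add: Field_card_suc)

lemma card_of_lessThan_suc:
  assumes "card_order (r :: 'a rel)"
  shows "|{..<x :: 'a suc}| \<le>o r"
proof -
  have "|{..<x}| <o card_suc r"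
    using card_of_underS[OF Card_order_card_suc[OF assms], of x]
    by (simp add: Field_card_suc underS_card_suc)
  then show ?thesis
    using card_suc_ordLess_imp_ordLeq[of "|{..<x}|" r] assms
    by (simp add: card_of_Card_order card_order_on_Card_order)
qed

lemma card_of_atMost_suc:
  assumes r: "card_order (r :: 'a rel)" and inf: "cinfinite r"
  shows "|{..x :: 'a suc}| \<le>o r"
proof -
  have co: "Card_order r" and "infinite (Field r)"
    using r inf by (auto simp: card_order_on_Card_order cinfinite_def)
  have "|{x} \<union> {..<x}| \<le>o r"
  proof (rule card_of_Un_ordLeq_infinite_Field[OF \<open>infinite (Field r)\<close> _ _ co])
    have "|{x}| \<le>o natLeq"
      using finite_iff_ordLess_natLeq[of "{x}"] by (simp add: ordLess_imp_ordLeq)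
    then show "|{x}| \<le>o r"
      using natLeq_ordLeq_cinfinite co inf ordLeq_transitive by blast
  qed (rule card_of_lessThan_suc[OF r])
  moreover have "{x} \<union> {..<x} = {..x}" by auto
  ultimately show ?thesis by simp
qed

section \<open>Cardinality and regularity of \<open>\<omega>\<^sub>1\<close>\<close>

lemma card_order_omega1: "card_order omega1"
  by (simp add: card_order_card_suc natLeq_card_order)

lemma cinfinite_omega1: "cinfinite omega1"
  using Cinfinite_card_suc[OF natLeq_Cinfinite natLeq_card_order] by simp

lemma card_of_UNIV_omega1: "|UNIV :: omega1 set| =o omega1"
  by (simp add: card_of_UNIV_card_suc natLeq_card_order)

lemma lessThan_omega1_range:
  fixes x :: omega1
  shows "\<exists>g :: nat \<Rightarrow> omega1. {..<x} \<subseteq> range g"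
proof (cases "{..<x} = {}")
  case False
  have "|{..<x}| \<le>o |UNIV :: nat set|"
    using ordLeq_ordIso_trans[OF card_of_lessThan_suc[OF natLeq_card_order] ordIso_symmetric[OF card_of_nat]] .
  then show ?thesis
    using card_of_ordLeq2[OF False, of "UNIV :: nat set"] by blast
qed simp

text \<open>Otherwise the countable initial segments \<open>{..x}\<close> with x in S would cover
  \<open>\<omega>\<^sub>1\<close>, making it countable.\<close>

lemma countable_bounded_omega1:
  fixes S :: "omega1 set"
  assumes "|S| \<le>o natLeq"
  shows "\<exists>b. \<forall>x\<in>S. x < b"
proof (rule ccontr)
  assume "\<nexists>b. \<forall>x\<in>S. x < b"
  then have "UNIV = (\<Union>x\<in>S. {..x})"
    by (force simp: not_less)
  moreover have "|\<Union>x\<in>S. {..x}| \<le>o natLeq"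
    using assms natLeq_Cinfinite
    by (intro card_of_UNION_ordLeq_infinite_Field)
      (auto simp: cinfinite_def natLeq_Card_order intro!: card_of_atMost_suc natLeq_card_order)
  ultimately have "|UNIV :: omega1 set| \<le>o natLeq" by simp
  then have "omega1 \<le>o natLeq"
    using card_of_UNIV_omega1 ordIso_ordLeq_trans ordIso_symmetric by blast
  then show False
    using card_suc_greater[OF natLeq_card_order] not_ordLess_ordLeq by blast
qed

text \<open>Organizes a set of levels: into \<open>\<omega>\<^sub>1\<close> countable blocks for
  \<open>nat\<close>, into two halves for \<open>bool\<close>.\<close>

lemma bij_betw_omega1_Times:
  assumes X: "|X| =o omega1" and le: "|UNIV :: 'b set| \<le>o natLeq"
  shows "\<exists>e. bij_betw e (UNIV :: (omega1 \<times> 'b) set) X"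
proof -
  have "natLeq \<le>o |UNIV :: omega1 set|"
    using card_suc_greater[OF natLeq_card_order] card_of_UNIV_omega1
      ordIso_symmetric ordLess_imp_ordLeq ordLeq_ordIso_trans by blast
  then have "|UNIV :: 'b set| \<le>o |UNIV :: omega1 set|" "infinite (UNIV :: omega1 set)"
    using le ordLeq_transitive infinite_iff_natLeq_ordLeq by blast+
  then have "|(UNIV :: omega1 set) \<times> (UNIV :: 'b set)| =o |UNIV :: omega1 set|"
    by (intro card_of_Times_infinite_simps) auto
  then have "|UNIV :: (omega1 \<times> 'b) set| =o |X|"
    using X card_of_UNIV_omega1 ordIso_symmetric ordIso_transitive by (metis UNIV_Times_UNIV)
  then show ?thesis by (simp add: card_of_ordIso)
qed

section \<open>Nodes as total functions and their codes\<close>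

text \<open>Only the values of \<open>t \<xi>\<close> below \<xi> count, so domains need not be
  tracked.\<close>

lemma strong_measure_zero_iff:
  "strong_measure_zero A \<longleftrightarrow>
     (\<forall>X. |X| =o omega1 \<longrightarrow>
        (\<exists>t :: omega1 \<Rightarrow> omega1 \<Rightarrow> bool. \<forall>\<eta>\<in>A. \<exists>\<xi>\<in>X. \<forall>\<nu><\<xi>. \<eta> \<nu> = t \<xi> \<nu>))"
  (is "_ \<longleftrightarrow> (\<forall>X. _ \<longrightarrow> ?R X)")
proof -
  have "(\<exists>f. (\<forall>\<xi>\<in>X. f \<xi> \<in> binary_seqs \<xi>) \<and> A \<subseteq> (\<Union>\<xi>\<in>X. basic_open (f \<xi>))) \<longleftrightarrow> ?R X"
    (is "?L \<longleftrightarrow> _") for X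
  proof
    assume ?L
    then obtain f where f: "\<And>\<xi>. \<xi> \<in> X \<Longrightarrow> dom (f \<xi>) = {..<\<xi>}" "A \<subseteq> (\<Union>\<xi>\<in>X. basic_open (f \<xi>))"
      by (auto simp: binary_seqs_def underS_card_suc)
    have "\<exists>\<xi>\<in>X. \<forall>\<nu><\<xi>. \<eta> \<nu> = the (f \<xi> \<nu>)" if \<eta>: "\<eta> \<in> A" for \<eta>
    proof -
      obtain \<xi> where \<xi>: "\<xi> \<in> X" "f \<xi> \<subseteq>\<^sub>m (Some \<circ> \<eta>)"
        using \<eta> f(2) unfolding basic_open_def by blast
      have "\<eta> \<nu> = the (f \<xi> \<nu>)" if "\<nu> < \<xi>" for \<nu>
        using that \<xi>(2) f(1)[OF \<xi>(1)] by (auto simp: map_le_def)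
      with \<xi>(1) show ?thesis by blast
    qed
    then show "?R X" by (intro exI[of _ "\<lambda>\<xi> \<nu>. the (f \<xi> \<nu>)"]) blast
  next
    assume "?R X"
    then obtain t :: "omega1 \<Rightarrow> omega1 \<Rightarrow> bool"
      where t: "\<And>\<eta>. \<eta> \<in> A \<Longrightarrow> \<exists>\<xi>\<in>X. \<forall>\<nu><\<xi>. \<eta> \<nu> = t \<xi> \<nu>" by blast
    have "A \<subseteq> (\<Union>\<xi>\<in>X. basic_open ((Some \<circ> t \<xi>) |` {..<\<xi>}))"
      using t by (fastforce simp: basic_open_def map_le_def)
    then show ?L
      by (intro exI[of _ "\<lambda>\<xi>. (Some \<circ> t \<xi>) |` {..<\<xi>}"])
        (auto simp: binary_seqs_def underS_card_suc)
  qed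
  then show ?thesis by (simp add: strong_measure_zero_def)
qed

text \<open>Nodes of the tree, i.e. elements of some \<open>\<^sup>\<xi>2\<close>, are represented by total functions that vanish from some point on.\<close>

lemma CH_enumeration:
  assumes CH: "ctwo ^c natLeq =o omega1"
  shows "\<exists>s :: omega1 \<Rightarrow> omega1 \<Rightarrow> bool. {p. \<exists>b. \<forall>\<nu>\<ge>b. \<not> p \<nu>} \<subseteq> range s"
proof -
  let ?B = "\<lambda>b :: omega1. {p :: omega1 \<Rightarrow> bool. \<forall>\<nu>\<ge>b. \<not> p \<nu>}"
  have "|?B b| \<le>o omega1" for b
  proof -
    obtain g :: "nat \<Rightarrow> omega1" where g: "{..<b} \<subseteq> range g" using lessThan_omega1_range by blast
    \<comment> \<open>Since g exhausts the ordinals below b, p is determined by the set of n with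
      \<open>p (g n)\<close>.\<close>
    have "?B b \<subseteq> (\<lambda>S \<nu>. \<nu> < b \<and> \<nu> \<in> g ` S) ` Pow UNIV"
    proof
      fix p assume "p \<in> ?B b"
      then have "p = (\<lambda>\<nu>. \<nu> < b \<and> \<nu> \<in> g ` {n. p (g n)})"
        using g by (fastforce simp: not_le[symmetric])
      then show "p \<in> (\<lambda>S \<nu>. \<nu> < b \<and> \<nu> \<in> g ` S) ` Pow UNIV" by blast
    qed
    then have "|?B b| \<le>o |Pow (UNIV :: nat set)|" by (rule surj_imp_ordLeq)
    also have "|Pow (UNIV :: nat set)| =o ctwo ^c natLeq"
      using card_of_Pow_Func[of "UNIV :: nat set"]
      by (simp add: cexp_def ctwo_def Field_natLeq Field_card_of)
    also note CH
    finally show ?thesis .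
  qed
  then have "|\<Union>b\<in>UNIV. ?B b| \<le>o omega1"
    using card_of_UNIV_omega1 cinfinite_omega1
    by (intro card_of_UNION_ordLeq_infinite_Field)
      (auto simp: cinfinite_def Card_order_card_suc natLeq_card_order intro: ordIso_imp_ordLeq)
  then have "|\<Union>b\<in>UNIV. ?B b| \<le>o |UNIV :: omega1 set|"
    using card_of_UNIV_omega1 ordIso_symmetric ordLeq_ordIso_trans by blast
  then obtain s where "s ` (UNIV :: omega1 set) = (\<Union>b\<in>UNIV. ?B b)"
    using card_of_ordLeq2[of "\<Union>b\<in>UNIV. ?B b" "UNIV :: omega1 set"] by auto
  then show ?thesis by (intro exI[of _ s]) auto
qed

section \<open>Domination from failure of strong measure zero\<close>

lemma not_strong_measure_zero_dominating:
  fixes s :: "omega1 \<Rightarrow> omega1 \<Rightarrow> bool"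
  assumes s: "{p. \<exists>b. \<forall>\<nu>\<ge>b. \<not> p \<nu>} \<subseteq> range s"
    and A: "\<not> strong_measure_zero A"
  shows "\<exists>d :: (omega1 \<Rightarrow> bool) \<Rightarrow> omega1 \<Rightarrow> omega1. \<forall>h. \<exists>\<eta>\<in>A. \<forall>i. h i \<le> d \<eta> i"
proof -
  obtain X where X: "|X| =o omega1"
    and nX: "\<nexists>t :: omega1 \<Rightarrow> omega1 \<Rightarrow> bool. \<forall>\<eta>\<in>A. \<exists>\<xi>\<in>X. \<forall>\<nu><\<xi>. \<eta> \<nu> = t \<xi> \<nu>"
    using A unfolding strong_measure_zero_iff not_all not_imp by (elim exE conjE)
  obtain e where e: "bij_betw e (UNIV :: (omega1 \<times> nat) set) X"
    using bij_betw_omega1_Times[OF X ordIso_imp_ordLeq[OF card_of_nat]] by blast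
  have "\<exists>b. \<forall>i n. e (i, n) < b i"
  proof -
    have "\<exists>b. \<forall>n. e (i, n) < b" for i
    proof -
      have "|range (\<lambda>n. e (i, n))| \<le>o natLeq"
        by (rule ordLeq_ordIso_trans[OF card_of_image card_of_nat])
      then show ?thesis using countable_bounded_omega1[of "range (\<lambda>n. e (i, n))"] by blast
    qed
    then show ?thesis by (intro choice) blast
  qed
  then obtain b where b: "\<And>i n. e (i, n) < b i" by blast
  define d where "d \<eta> i = inv s (\<lambda>\<nu>. \<nu> < b i \<and> \<eta> \<nu>)" for \<eta> i
  have d: "s (d \<eta> i) = (\<lambda>\<nu>. \<nu> < b i \<and> \<eta> \<nu>)" for \<eta> i
    unfolding d_def by (rule f_inv_into_f, rule subsetD[OF s]) (auto intro!: exI[of _ "b i"])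
  have "\<exists>\<eta>\<in>A. \<forall>i. h i \<le> d \<eta> i" for h :: "omega1 \<Rightarrow> omega1"
  proof -
    have "\<forall>i. \<exists>g :: nat \<Rightarrow> omega1. {..<h i} \<subseteq> range g"
      by (intro allI lessThan_omega1_range)
    from choice[OF this] obtain g :: "omega1 \<Rightarrow> nat \<Rightarrow> omega1"
      where g: "\<And>i. {..<h i} \<subseteq> range (g i)" by auto
    define t where "t \<xi> = (case inv e \<xi> of (i, n) \<Rightarrow> s (g i n))" for \<xi>
    have te: "t (e (i, n)) = s (g i n)" for i n
      using e by (simp add: t_def bij_betw_def)
    have "\<not> (\<forall>\<eta>\<in>A. \<exists>\<xi>\<in>X. \<forall>\<nu><\<xi>. \<eta> \<nu> = t \<xi> \<nu>)"
      using nX by (rule contrapos_nn) (rule exI)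
    then obtain \<eta> where \<eta>: "\<eta> \<in> A" "\<And>\<xi>. \<xi> \<in> X \<Longrightarrow> \<exists>\<nu><\<xi>. \<eta> \<nu> \<noteq> t \<xi> \<nu>"
      by auto
    have "h i \<le> d \<eta> i" for i
    proof (rule ccontr)
      assume "\<not> h i \<le> d \<eta> i"
      \<comment> \<open>The node coded by \<open>g i n\<close> agrees with \<eta> below
        \<open>b i\<close>, hence below the level \<open>e (i, n)\<close>, so t captures \<eta>
        there.\<close>
      then obtain n where n: "g i n = d \<eta> i" using g[of i] by (force simp: not_le)
      have "e (i, n) \<in> X" using e by (auto simp: bij_betw_def)
      then obtain \<nu> where "\<nu> < e (i, n)" "\<eta> \<nu> \<noteq> t (e (i, n)) \<nu>" using \<eta>(2) by blast
      then show False using b[of i n] by (auto simp: te n d)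
    qed
    with \<eta>(1) show ?thesis by blast
  qed
  then show ?thesis by (intro exI allI)
qed

section \<open>The Luzin construction\<close>

text \<open>
  The point \<open>\<eta>\<close> vanishes outside an increasing sequence of positions \<open>f a\<close>, where the value is chosen
  to differ from \<open>c a\<close>. So \<open>\<eta>\<close> agrees below \<open>f a\<close> with a sequence \<open>p f a\<close> fixed before stage \<open>a\<close>,
  and it suffices to choose \<open>f a\<close> beyond \<open>d a i\<close> for the index \<open>i\<close> of that sequence.
\<close>

lemma omega1_Baire:
  fixes s :: "omega1 \<Rightarrow> omega1 \<Rightarrow> bool"
    and d :: "omega1 \<Rightarrow> omega1 \<Rightarrow> omega1" and c :: "omega1 \<Rightarrow> omega1 \<Rightarrow> bool"
  assumes s: "{p. \<exists>b. \<forall>\<nu>\<ge>b. \<not> p \<nu>} \<subseteq> range s"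
  shows "\<exists>\<eta>. (\<forall>a. \<exists>i. \<forall>\<nu><d a i. \<eta> \<nu> = s i \<nu>) \<and> (\<forall>a. \<eta> \<noteq> c a)"
proof -
  define p where "p f a = (\<lambda>\<nu>. \<exists>b<a. \<nu> = f b \<and> \<not> c b \<nu>)" for f a
  have "\<exists>f. \<forall>a. (\<forall>b<a. f b < f a) \<and> (\<exists>i. s i = p f a \<and> d a i \<le> f a)"
  proof (rule dependent_wellorder_choice)
    fix f g :: "omega1 \<Rightarrow> omega1" and x r
    assume "\<And>y. y < x \<Longrightarrow> f y = g y"
    moreover from this have "p f x = p g x" unfolding p_def by (intro ext) auto
    ultimately show "((\<forall>b<x. f b < r) \<and> (\<exists>i. s i = p f x \<and> d x i \<le> r)) =
        ((\<forall>b<x. g b < r) \<and> (\<exists>i. s i = p g x \<and> d x i \<le> r))" by simp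
  next
    fix f :: "omega1 \<Rightarrow> omega1" and x
    have "|f ` {..<x}| \<le>o natLeq"
      using card_of_image card_of_lessThan_suc[OF natLeq_card_order] ordLeq_transitive by blast
    then obtain u where u: "\<And>y. y \<in> f ` {..<x} \<Longrightarrow> y < u"
      using countable_bounded_omega1[of "f ` {..<x}"] by blast
    have "p f x \<in> range s"
      by (rule subsetD[OF s]) (use u in \<open>auto simp: p_def simp flip: not_less intro!: exI[of _ u]\<close>)
    then obtain i where "s i = p f x" by (metis rangeE)
    then show "\<exists>r. (\<forall>b<x. f b < r) \<and> (\<exists>i. s i = p f x \<and> d x i \<le> r)"
      using u by (intro exI[of _ "max u (d x i)"]) (force simp: less_max_iff_disj)
  qed
  then obtain f where f: "\<And>a b. b < a \<Longrightarrow> f b < f a"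
    and i: "\<And>a. \<exists>i. s i = p f a \<and> d a i \<le> f a" by blast
  have f_less: "f b < f a \<longleftrightarrow> b < a" for a b
    using f by (metis less_asym less_linear)
  define \<eta> where "\<eta> \<nu> \<longleftrightarrow> (\<exists>a. \<nu> = f a \<and> \<not> c a \<nu>)" for \<nu>
  have "\<exists>i. \<forall>\<nu><d a i. \<eta> \<nu> = s i \<nu>" for a
  proof -
    obtain i where i: "s i = p f a" "d a i \<le> f a" using i by blast
    \<comment> \<open>A position \<open>f a'\<close> below \<open>d a i \<le> f a\<close> has
      \<open>a' < a\<close>, so it is already recorded in \<open>p f a\<close>.\<close>
    have "\<eta> \<nu> = s i \<nu>" if "\<nu> < d a i" for \<nu>
      using that i(2) f_less[of _ a] unfolding i(1) p_def \<eta>_def by (metis less_le_trans)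
    then show ?thesis by blast
  qed
  moreover have "\<eta> \<noteq> c a" for a
  proof
    assume "\<eta> = c a"
    moreover have "f b = f a \<longleftrightarrow> b = a" for b using f by (metis less_irrefl less_linear)
    then have "\<eta> (f a) \<longleftrightarrow> \<not> c a (f a)" unfolding \<eta>_def by metis
    ultimately show False by simp
  qed
  ultimately show ?thesis by blast
qed

lemma dominating_strong_measure_zero:
  fixes s :: "omega1 \<Rightarrow> omega1 \<Rightarrow> bool" and d :: "omega1 suc \<Rightarrow> omega1 \<Rightarrow> omega1"
  assumes s: "{p. \<exists>b. \<forall>\<nu>\<ge>b. \<not> p \<nu>} \<subseteq> range s"
    and d: "\<And>h. \<exists>\<alpha>. \<forall>i. h i \<le> d \<alpha> i"
  shows "\<exists>f :: omega1 suc \<Rightarrow> omega1 \<Rightarrow> bool. inj f \<and> strong_measure_zero (range f)"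
proof -
  have surj: "\<exists>g. g ` (UNIV :: omega1 set) = {..\<alpha>}" for \<alpha> :: "omega1 suc"
  proof -
    have "|{..\<alpha>}| \<le>o |UNIV :: omega1 set|"
      using card_of_atMost_suc[OF card_order_omega1 cinfinite_omega1] card_of_UNIV_omega1
        ordIso_symmetric ordLeq_ordIso_trans by blast
    moreover have "{..\<alpha>} \<noteq> {}" by auto
    ultimately show ?thesis by (simp add: card_of_ordLeq2)
  qed
  have "\<exists>f. \<forall>\<alpha>. (\<forall>\<beta>\<le>\<alpha>. \<exists>i. \<forall>\<nu><d \<beta> i. f \<alpha> \<nu> = s i \<nu>) \<and> (\<forall>\<beta><\<alpha>. f \<alpha> \<noteq> f \<beta>)"
  proof (rule dependent_wellorder_choice)
    fix f :: "omega1 suc \<Rightarrow> omega1 \<Rightarrow> bool" and \<alpha>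
    obtain g :: "omega1 \<Rightarrow> omega1 suc" where g: "range g = {..\<alpha>}" using surj by blast
    \<comment> \<open>As g lists all indices up to \<alpha>, one Baire argument handles the whole
      stage. It also avoids the still arbitrary value \<open>f \<alpha>\<close>, which is
      harmless.\<close>
    have "\<exists>\<eta>. (\<forall>a. \<exists>i. \<forall>\<nu><d (g a) i. \<eta> \<nu> = s i \<nu>) \<and> (\<forall>a. \<eta> \<noteq> f (g a))"
      by (rule omega1_Baire[OF s])
    then obtain \<eta> where \<eta>: "\<And>a. \<exists>i. \<forall>\<nu><d (g a) i. \<eta> \<nu> = s i \<nu>" "\<And>a. \<eta> \<noteq> f (g a)"
      by auto
    have *: "\<exists>a. \<beta> = g a" if "\<beta> \<le> \<alpha>" for \<beta>
      using that g by (metis atMost_iff rangeE)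
    have "\<exists>i. \<forall>\<nu><d \<beta> i. \<eta> \<nu> = s i \<nu>" "\<eta> \<noteq> f \<beta>" if "\<beta> \<le> \<alpha>" for \<beta>
      using *[OF that] \<eta> by auto
    then show "\<exists>r. (\<forall>\<beta>\<le>\<alpha>. \<exists>i. \<forall>\<nu><d \<beta> i. r \<nu> = s i \<nu>) \<and> (\<forall>\<beta><\<alpha>. r \<noteq> f \<beta>)"
      by (intro exI[of _ \<eta>]) auto
  qed auto
  then obtain f where f: "\<And>\<alpha> \<beta>. \<beta> \<le> \<alpha> \<Longrightarrow> \<exists>i. \<forall>\<nu><d \<beta> i. f \<alpha> \<nu> = s i \<nu>"
    and f_neq: "\<And>\<alpha> \<beta>. \<beta> < \<alpha> \<Longrightarrow> f \<alpha> \<noteq> f \<beta>" by blast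
  have "inj f" using f_neq by (metis injI less_linear)
  moreover have "strong_measure_zero (range f)"
    unfolding strong_measure_zero_iff
  proof (intro allI impI)
    fix X :: "omega1 set" assume X: "|X| =o omega1"
    have "|UNIV :: bool set| \<le>o natLeq"
      using finite_iff_ordLess_natLeq[of "UNIV :: bool set"] by (simp add: ordLess_imp_ordLeq)
    then obtain e where e: "bij_betw e (UNIV :: (omega1 \<times> bool) set) X"
      using bij_betw_omega1_Times[OF X] by blast
    have inv_e: "inv e (e z) = z" and e_X: "e z \<in> X" for z
      using e by (auto simp: bij_betw_def)
    obtain \<alpha> where \<alpha>: "\<And>i. e (i, True) \<le> d \<alpha> i" using d[of "\<lambda>i. e (i, True)"] by blast
    obtain g :: "omega1 \<Rightarrow> omega1 suc" where g: "range g = {..\<alpha>}" using surj by blast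
    \<comment> \<open>The \<open>True\<close> half carries the enumerated nodes; the
      \<open>False\<close> half lists the points \<open>f \<gamma>\<close> with
      \<open>\<gamma> \<le> \<alpha>\<close>.\<close>
    define t where "t \<xi> = (case inv e \<xi> of (i, b) \<Rightarrow> if b then s i else f (g i))" for \<xi>
    have "\<exists>\<xi>\<in>X. \<forall>\<nu><\<xi>. f \<gamma> \<nu> = t \<xi> \<nu>" for \<gamma>
    proof (cases "\<alpha> \<le> \<gamma>")
      case True
      then obtain i where "\<And>\<nu>. \<nu> < d \<alpha> i \<Longrightarrow> f \<gamma> \<nu> = s i \<nu>" using f by blast
      then show ?thesis
        using \<alpha>[of i] by (intro bexI[OF _ e_X[of "(i, True)"]]) (auto simp: t_def inv_e)
    next
      case False
      then obtain i where "\<gamma> = g i" using g by (metis atMost_iff linear rangeE)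
      then show ?thesis
        by (intro bexI[OF _ e_X[of "(i, False)"]]) (auto simp: t_def inv_e)
    qed
    then show "\<exists>t. \<forall>\<eta>\<in>range f. \<exists>\<xi>\<in>X. \<forall>\<nu><\<xi>. \<eta> \<nu> = t \<xi> \<nu>" by blast
  qed
  ultimately show ?thesis by blast
qed

theorem theorem3p1:
  assumes CH: "ctwo ^c natLeq =o omega1"
  shows "\<not> GBC \<and> (\<exists>A. strong_measure_zero A \<and> omega1 <o |A| )"
proof -
  obtain s :: "omega1 \<Rightarrow> omega1 \<Rightarrow> bool"
    where s: "{p. \<exists>b. \<forall>\<nu>\<ge>b. \<not> p \<nu>} \<subseteq> range s"
    using CH_enumeration[OF CH] by blast
  have large: "omega1 <o |range f|" if "inj f" for f :: "omega1 suc \<Rightarrow> omega1 \<Rightarrow> bool"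
  proof -
    have "|UNIV :: omega1 suc set| =o |range f|"
      using inj_on_imp_bij_betw[OF that] card_of_ordIso by blast
    then have "card_suc omega1 =o |range f|"
      using ordIso_symmetric[OF card_of_UNIV_card_suc[OF card_order_omega1]]
      by (rule ordIso_transitive[rotated])
    with card_suc_greater[OF card_order_omega1] show ?thesis by (rule ordLess_ordIso_trans)
  qed
  obtain f :: "omega1 suc \<Rightarrow> omega1 \<Rightarrow> bool" where f: "inj f"
  proof -
    have "|Pow (UNIV :: omega1 set)| =o |UNIV :: (omega1 \<Rightarrow> bool) set|"
      using card_of_Pow_Func[of "UNIV :: omega1 set"] by (simp add: Func_def)
    then have "omega1 <o |UNIV :: (omega1 \<Rightarrow> bool) set|"
      using ordIso_ordLess_trans[OF ordIso_symmetric[OF card_of_UNIV_omega1] card_of_Pow]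
      by (rule ordLess_ordIso_trans[rotated])
    then have "card_suc omega1 \<le>o |UNIV :: (omega1 \<Rightarrow> bool) set|"
      by (intro card_suc_least card_order_omega1 card_of_Card_order)
    then have "|UNIV :: omega1 suc set| \<le>o |UNIV :: (omega1 \<Rightarrow> bool) set|"
      using card_of_UNIV_card_suc[OF card_order_omega1] ordIso_ordLeq_trans by blast
    then show ?thesis unfolding card_of_ordLeq[symmetric] by (elim exE conjE) (rule that)
  qed
  \<comment> \<open>Either \<open>range f\<close> itself works, or its failure gives a dominating
    family indexed through f by \<open>\<omega>\<^sub>2\<close>, and the Luzin construction
    applies.\<close>
  obtain A where A: "strong_measure_zero A" "omega1 <o |A|"
  proof (cases "strong_measure_zero (range f)")
    case True
    then show ?thesis using that large[OF f] by blast
  next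
    case False
    from not_strong_measure_zero_dominating[OF s this]
    obtain d :: "(omega1 \<Rightarrow> bool) \<Rightarrow> omega1 \<Rightarrow> omega1"
      where d: "\<And>h. \<exists>\<eta>\<in>range f. \<forall>i. h i \<le> d \<eta> i" by auto
    have "\<exists>g :: omega1 suc \<Rightarrow> omega1 \<Rightarrow> bool. inj g \<and> strong_measure_zero (range g)"
    proof (rule dominating_strong_measure_zero[OF s])
      show "\<exists>\<alpha>. \<forall>i. h i \<le> d (f \<alpha>) i" for h using d[of h] by blast
    qed
    then show ?thesis using that large by blast
  qed
  then have "\<not> GBC" unfolding GBC_def using not_ordLess_ordLeq by blast
  with A show ?thesis by blast
qed

end
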